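(* Let $J$ be an ideal on $\omega$. The following are equivalent: (i) $\mathcal{N}_J\subsetneq\mathcal{N}$; (ii) $\mathcal{M}\cap\mathcal{N}\not\subseteq\mathcal{N}_J$; (iii) $J$ is not meager.
   Context: An ideal on $\omega$ is a family $J\subseteq\mathcal{P}(\omega)$ closed under subsets and finite unions, containing all finite sets, with $\omega\notin J$; it is viewed as a subset of $\mathcal{P}(\omega)\cong{}^\omega2$ for "meager". $J^+=\mathcal{P}(\omega)\setminus J$. ${}^\omega2$ has Lebesgue measure $\mu$; $\Omega$ is the set of clopen subsets. For $\bar c\in{}^\omega\Omega$, $N(\bar c)=\{x:x\in c_n\text{ for infinitely many }n\}$, $\overline{\Omega}=\{\bar c\in{}^\omega\Omega:\mu(N(\bar c))=0\}$, $N_J(\bar c)=\{x:\{n:x\in c_n\}\in J^+\}$, $\mathcal{N}_J=\{X\subseteq{}^\omega2:\exists\bar c\in\overline{\Omega}\ X\subseteq N_J(\bar c)\}$. $\mathcal{N}$ and $\mathcal{M}$ are the ideals of Lebesgue null and of meager subsets of ${}^\omega2$. *)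

theory Defs
  imports "HOL-Probability.Probability"
begin

type_synonym cantor = "nat \<Rightarrow> bool"

definition ideal_on_omega :: "nat set set \<Rightarrow> bool" where
  "ideal_on_omega J \<longleftrightarrow>
     (\<forall>A\<in>J. \<forall>B. B \<subseteq> A \<longrightarrow> B \<in> J) \<and>
     (\<forall>A\<in>J. \<forall>B\<in>J. A \<union> B \<in> J) \<and>
     (\<forall>A. finite A \<longrightarrow> A \<in> J) \<and>
     UNIV \<notin> J"

definition positive_sets :: "nat set set \<Rightarrow> nat set set" where
  "positive_sets J = UNIV - J"

definition nowhere_dense :: "'a::topological_space set \<Rightarrow> bool" where
  "nowhere_dense A \<longleftrightarrow> interior (closure A) = {}"

definition meager :: "'a::topological_space set \<Rightarrow> bool" where
  "meager A \<longleftrightarrow> (\<exists>F :: nat \<Rightarrow> 'a set. (\<forall>n. nowhere_dense (F n)) \<and> A = (\<Union>n. F n))"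

text \<open>A family of subsets of \<open>\<omega>\<close> viewed as a subset of the Cantor space, via
  characteristic functions.\<close>

definition cantor_of :: "nat set set \<Rightarrow> cantor set" where
  "cantor_of J = (\<lambda>A n. n \<in> A) ` J"

text \<open>Lebesgue measure on the Cantor space is the completed product of the fair-coin measures.
  Nullness is always expressed by \<^const>\<open>null_sets\<close>, because \<^const>\<open>emeasure\<close> takes the
  value 0 on non-measurable sets.\<close>

definition cantor_measure :: "cantor measure" where
  "cantor_measure = completion (Pi\<^sub>M UNIV (\<lambda>_. measure_pmf (bernoulli_pmf (1/2))))"

definition null_ideal :: "cantor set set" where
  "null_ideal = null_sets cantor_measure"

definition meager_ideal :: "cantor set set" where
  "meager_ideal = {X. meager X}"

definition clopen_sets :: "cantor set set" where
  "clopen_sets = {c. open c \<and> closed c}"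

definition N_limsup :: "(nat \<Rightarrow> cantor set) \<Rightarrow> cantor set" where
  "N_limsup c = {x. infinite {n. x \<in> c n}}"

definition Omega_bar :: "(nat \<Rightarrow> cantor set) set" where
  "Omega_bar = {c. (\<forall>n. c n \<in> clopen_sets) \<and> N_limsup c \<in> null_sets cantor_measure}"

definition N_J_set :: "nat set set \<Rightarrow> (nat \<Rightarrow> cantor set) \<Rightarrow> cantor set" where
  "N_J_set J c = {x. {n. x \<in> c n} \<in> positive_sets J}"

definition N_J_family :: "nat set set \<Rightarrow> cantor set set" where
  "N_J_family J = {X. \<exists>c\<in>Omega_bar. X \<subseteq> N_J_set J c}"

end

theory Submission
  imports Defs
begin

text \<open>If \<open>J\<close> is meager, there is an interval partition such that no set in \<open>J\<close> contains infinitely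
  many of the intervals; repeating \<open>c k\<close> along the \<open>k\<close>-th interval gives \<open>N(c) \<subseteq> N\<^sub>J(c')\<close>, and every
  null set lies in some \<open>N(c)\<close>.

  If \<open>J\<close> is not meager, every interval partition has infinitely many intervals inside one set of
  \<open>J\<close>. The null meager set that escapes \<open>N\<^sub>J\<close> consists of the points that vanish on infinitely many
  dyadic blocks but equal 1 throughout only finitely many. Given \<open>c\<close>, interleave a partition of the
  indices of \<open>c\<close> with dyadic blocks so that earlier \<open>c n\<close> do not depend on a block, while later ones
  are tiny compared with the measure of the points vanishing on it. A random point made to vanish on
  the blocks with index in an infinite set \<open>K\<close> then avoids, with positive probability, all \<open>c n\<close>
  outside the intervals with index in \<open>K\<close>.\<close>

section \<open>Cylinders\<close>

definition cylinder :: "('i \<Rightarrow> 'a) \<Rightarrow> 'i set \<Rightarrow> ('i \<Rightarrow> 'a) set" where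
  "cylinder x S = {y. \<forall>i\<in>S. y i = x i}"

definition determined_by :: "'i set \<Rightarrow> ('i \<Rightarrow> 'a) set \<Rightarrow> bool" where
  "determined_by S c \<longleftrightarrow> (\<forall>x\<in>c. cylinder x S \<subseteq> c)"

lemma self_in_cylinder [simp]: "x \<in> cylinder x S"
  by (simp add: cylinder_def)

lemma cylinder_antimono: "S \<subseteq> T \<Longrightarrow> cylinder x T \<subseteq> cylinder x S"
  by (auto simp: cylinder_def)

lemma cylinder_eq: "y \<in> cylinder x S \<Longrightarrow> cylinder y S = cylinder x S"
  by (auto simp: cylinder_def)

lemma determined_by_mono: "determined_by S c \<Longrightarrow> S \<subseteq> T \<Longrightarrow> determined_by T c"
  unfolding determined_by_def using cylinder_antimono by blast

lemma determined_by_cong: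
  assumes "determined_by S c" "\<And>i. i \<in> S \<Longrightarrow> x i = y i"
  shows "x \<in> c \<longleftrightarrow> y \<in> c"
proof -
  have "x \<in> cylinder y S" "y \<in> cylinder x S"
    using assms(2) by (simp_all add: cylinder_def)
  then show ?thesis using assms(1) by (auto simp: determined_by_def)
qed

lemma determined_by_Compl:
  assumes "determined_by S c"
  shows "determined_by S (- c)"
  using determined_by_cong[OF assms] unfolding determined_by_def cylinder_def by blast

lemma determined_by_UN:
  "(\<And>i. i \<in> I \<Longrightarrow> determined_by S (c i)) \<Longrightarrow> determined_by S (\<Union>i\<in>I. c i)"
  unfolding determined_by_def by blast

lemma open_cylinder:
  fixes x :: "'i \<Rightarrow> 'a::discrete_topology"
  assumes "finite S"
  shows "open (cylinder x S)"
proof -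
  have "open {y. \<forall>i\<in>S. y (id i) \<in> {x i}}"
    using assms
    by (intro product_topology_basis') (simp_all add: discrete_topology_class.open_discrete)
  then show ?thesis by (simp add: cylinder_def)
qed

lemma open_contains_cylinder:
  fixes U :: "('i \<Rightarrow> 'a::topological_space) set"
  assumes "open U" "x \<in> U"
  obtains S where "finite S" "cylinder x S \<subseteq> U"
proof -
  obtain X where X: "x \<in> Pi\<^sub>E UNIV X" "finite {i. X i \<noteq> UNIV}" "Pi\<^sub>E UNIV X \<subseteq> U"
    using product_topology_open_contains_basis[of "\<lambda>_. euclidean" UNIV U x] assms
    by (auto simp: open_fun_def)
  have "cylinder x {i. X i \<noteq> UNIV} \<subseteq> Pi\<^sub>E UNIV X"
  proof
    fix y assume y: "y \<in> cylinder x {i. X i \<noteq> UNIV}"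
    have "y i \<in> X i" for i
      using y X(1) by (cases "X i = UNIV") (auto simp: cylinder_def PiE_iff)
    then show "y \<in> Pi\<^sub>E UNIV X" by (simp add: PiE_iff)
  qed
  with X(2,3) show ?thesis by (blast intro: that)
qed

lemma open_if_determined_by:
  fixes c :: "('i \<Rightarrow> 'a::discrete_topology) set"
  assumes "finite S" "determined_by S c"
  shows "open c"
proof -
  have "c = (\<Union>x\<in>c. cylinder x S)"
    using assms(2) by (auto simp: determined_by_def)
  then show ?thesis
    using open_cylinder[OF assms(1)] by (metis open_UN)
qed

lemma closed_if_determined_by:
  fixes c :: "('i \<Rightarrow> 'a::discrete_topology) set"
  assumes "finite S" "determined_by S c"
  shows "closed c"
  unfolding closed_def by (rule open_if_determined_by[OF assms(1) determined_by_Compl[OF assms(2)]])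

lemma compact_UNIV_fun: "compact (UNIV :: ('i \<Rightarrow> 'a::{finite, topological_space}) set)"
proof -
  have "compact_space (product_topology (\<lambda>_. euclidean :: 'a topology) (UNIV :: 'i set))"
    unfolding compact_space_product_topology
    by (simp add: compact_space_def finite_imp_compact)
  then show ?thesis
    by (simp add: euclidean_product_topology compact_space_def)
qed

lemma clopen_determined_by_finite:
  fixes c :: "('i \<Rightarrow> 'a::{finite, discrete_topology}) set"
  assumes "open c" "closed c"
  obtains S where "finite S" "determined_by S c"
proof -
  have "\<exists>S. finite S \<and> (cylinder x S \<subseteq> c \<or> cylinder x S \<subseteq> - c)" for x
    using open_contains_cylinder[OF assms(1), of x]
      open_contains_cylinder[OF open_Compl[OF assms(2)], of x] by (metis ComplI)
  then obtain S where S: "\<And>x. finite (S x)"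
      "\<And>x. cylinder x (S x) \<subseteq> c \<or> cylinder x (S x) \<subseteq> - c"
    by metis
  obtain T where T: "finite T" "UNIV \<subseteq> (\<Union>x\<in>T. cylinder x (S x))"
    by (rule compactE_image[OF compact_UNIV_fun, of UNIV "\<lambda>x. cylinder x (S x)"])
       (use S(1) self_in_cylinder in \<open>auto simp: open_cylinder\<close>)
  have "determined_by (\<Union>x\<in>T. S x) c"
    unfolding determined_by_def
  proof
    fix y assume y: "y \<in> c"
    obtain x where x: "x \<in> T" "y \<in> cylinder x (S x)" using T(2) by blast
    have "cylinder y (\<Union>x\<in>T. S x) \<subseteq> cylinder y (S x)"
      using x(1) by (intro cylinder_antimono) blast
    also have "\<dots> = cylinder x (S x)" by (rule cylinder_eq[OF x(2)])
    finally show "cylinder y (\<Union>x\<in>T. S x) \<subseteq> c" using S(2)[of x] x(2) y by blast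
  qed
  with T(1) S(1) show ?thesis by (intro that[of "\<Union>x\<in>T. S x"]) simp_all
qed

section \<open>Nowhere dense sets and finite alterations\<close>

lemma nowhere_dense_subset:
  assumes "nowhere_dense B" "A \<subseteq> B"
  shows "nowhere_dense A"
  using assms interior_mono[OF closure_mono[OF assms(2)]] by (auto simp: nowhere_dense_def)

lemma nowhere_dense_Un: "nowhere_dense A \<Longrightarrow> nowhere_dense B \<Longrightarrow> nowhere_dense (A \<union> B)"
  by (simp add: nowhere_dense_def interior_closed_Un_empty_interior)

lemma nowhere_dense_UN:
  assumes "finite I" "\<And>i. i \<in> I \<Longrightarrow> nowhere_dense (F i)"
  shows "nowhere_dense (\<Union>i\<in>I. F i)"
  using assms
proof (induction I)
  case empty
  then show ?case by (simp add: nowhere_dense_def)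
next
  case (insert i I)
  then show ?case by (simp add: nowhere_dense_Un)
qed

lemma meager_subset:
  assumes "meager B" "A \<subseteq> B"
  shows "meager A"
proof -
  obtain F where F: "\<And>n::nat. nowhere_dense (F n)" "B = (\<Union>n. F n)"
    using assms(1) by (auto simp: meager_def)
  have "A = (\<Union>n. F n \<inter> A)" using F(2) assms(2) by auto
  moreover have "nowhere_dense (F n \<inter> A)" for n
    using nowhere_dense_subset[OF F(1)] by blast
  ultimately show ?thesis unfolding meager_def by metis
qed

lemma nowhere_dense_iff_cylinder:
  fixes F :: "('i \<Rightarrow> 'a::discrete_topology) set"
  shows "nowhere_dense F \<longleftrightarrow>
    (\<forall>x S. finite S \<longrightarrow> (\<exists>y\<in>cylinder x S. \<exists>T. finite T \<and> cylinder y T \<inter> F = {}))"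
    (is "_ \<longleftrightarrow> ?avoid")
proof
  assume F: "nowhere_dense F"
  show ?avoid
  proof (intro allI impI)
    fix x :: "'i \<Rightarrow> 'a" and S :: "'i set" assume S: "finite S"
    have "\<not> cylinder x S \<subseteq> closure F"
      using F interior_maximal[OF _ open_cylinder[OF S]] self_in_cylinder[of x S]
      unfolding nowhere_dense_def by blast
    then obtain y where y: "y \<in> cylinder x S" "y \<in> - closure F" by blast
    obtain T where "finite T" "cylinder y T \<subseteq> - closure F"
      using open_contains_cylinder[OF open_Compl[OF closed_closure] y(2)] .
    with y(1) show "\<exists>y\<in>cylinder x S. \<exists>T. finite T \<and> cylinder y T \<inter> F = {}"
      using closure_subset[of F] by blast
  qed
next
  assume avoid: ?avoid
  have "x \<notin> interior (closure F)" for x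
  proof
    assume "x \<in> interior (closure F)"
    then obtain S where S: "finite S" "cylinder x S \<subseteq> closure F"
      by (meson open_contains_cylinder open_interior interior_subset subset_trans)
    obtain y T where y: "y \<in> cylinder x S" and T: "finite T" "cylinder y T \<inter> F = {}"
      using avoid S(1) by blast
    have "cylinder y T \<inter> closure F = {}"
      using T by (simp add: open_Int_closure_eq_empty open_cylinder)
    then show False using y S(2) self_in_cylinder by blast
  qed
  then show "nowhere_dense F" by (auto simp: nowhere_dense_def)
qed

definition flip :: "'i set \<Rightarrow> ('i \<Rightarrow> bool) \<Rightarrow> 'i \<Rightarrow> bool" where
  "flip S x = (\<lambda>i. x i \<noteq> (i \<in> S))"

definition alterations :: "'i set \<Rightarrow> ('i \<Rightarrow> 'a) set \<Rightarrow> ('i \<Rightarrow> 'a) set" where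
  "alterations Z A = (\<Union>x\<in>A. cylinder x (- Z))"


lemma flip_in_cylinder_iff: "flip S y \<in> cylinder x T \<longleftrightarrow> y \<in> cylinder (flip S x) T"
  by (auto simp: flip_def cylinder_def)

lemma alterations_eq_UN_flip: "alterations Z A = (\<Union>S\<in>Pow Z. flip S -` A)"
proof
  show "alterations Z A \<subseteq> (\<Union>S\<in>Pow Z. flip S -` A)"
  proof
    fix y assume "y \<in> alterations Z A"
    then obtain x where x: "x \<in> A" "y \<in> cylinder x (- Z)" by (auto simp: alterations_def)
    have "flip {i. x i \<noteq> y i} y = x" by (auto simp: flip_def)
    moreover have "{i. x i \<noteq> y i} \<subseteq> Z" using x(2) by (auto simp: cylinder_def)
    ultimately show "y \<in> (\<Union>S\<in>Pow Z. flip S -` A)" using x(1) by blast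
  qed
  show "(\<Union>S\<in>Pow Z. flip S -` A) \<subseteq> alterations Z A"
  proof
    fix y assume "y \<in> (\<Union>S\<in>Pow Z. flip S -` A)"
    then obtain S where S: "S \<subseteq> Z" "flip S y \<in> A" by blast
    have "y \<in> cylinder (flip S y) (- Z)" using S(1) by (auto simp: cylinder_def flip_def)
    with S(2) show "y \<in> alterations Z A" by (auto simp: alterations_def)
  qed
qed

lemma nowhere_dense_vimage_flip:
  assumes "nowhere_dense F"
  shows "nowhere_dense (flip S -` F)"
  unfolding nowhere_dense_iff_cylinder
proof (intro allI impI)
  fix x :: "'a \<Rightarrow> bool" and T :: "'a set" assume "finite T"
  then obtain y U where y: "y \<in> cylinder (flip S x) T" and U: "finite U" "cylinder y U \<inter> F = {}"
    using assms unfolding nowhere_dense_iff_cylinder by metis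
  have "flip S y \<in> cylinder x T" using y by (simp add: flip_in_cylinder_iff)
  moreover have "cylinder (flip S y) U \<inter> flip S -` F = {}"
    using U(2) by (auto simp flip: flip_in_cylinder_iff)
  ultimately show "\<exists>y\<in>cylinder x T. \<exists>U. finite U \<and> cylinder y U \<inter> flip S -` F = {}"
    using U(1) by blast
qed

lemma nowhere_dense_alterations:
  fixes F :: "('i \<Rightarrow> bool) set"
  assumes "finite Z" "nowhere_dense F"
  shows "nowhere_dense (alterations Z F)"
  unfolding alterations_eq_UN_flip
  using assms by (intro nowhere_dense_UN) (auto intro: nowhere_dense_vimage_flip)

lemma nowhere_dense_avoiding_interval:
  fixes F :: "cantor set"
  assumes "nowhere_dense F"
  obtains m s where "n < m" "cylinder s {n..<m} \<inter> F = {}"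
proof -
  have "nowhere_dense (alterations {..<n} F)"
    using assms by (intro nowhere_dense_alterations) simp_all
  then obtain s T where T: "finite T" "cylinder s T \<inter> alterations {..<n} F = {}"
    unfolding nowhere_dense_iff_cylinder by (meson finite.emptyI)
  obtain m where m: "T \<subseteq> {..<m}"
    using T(1) finite_nat_iff_bounded by blast
  have "x \<notin> F" if x: "x \<in> cylinder s {n..<max m (Suc n)}" for x
  proof
    assume "x \<in> F"
    define y where "y = (\<lambda>i. if i < n then s i else x i)"
    have "y \<in> cylinder s T" using x m by (auto simp: y_def cylinder_def)
    moreover have "y \<in> alterations {..<n} F"
      using \<open>x \<in> F\<close> by (auto simp: alterations_def cylinder_def y_def)
    ultimately show False using T(2) by blast
  qed
  then show ?thesis by (intro that[of "max m (Suc n)" s]) auto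
qed

section \<open>Meager sets and interval partitions\<close>

definition block :: "(nat \<Rightarrow> nat) \<Rightarrow> nat \<Rightarrow> nat set" where
  "block m k = {m k..<m (Suc k)}"

definition block_index :: "(nat \<Rightarrow> nat) \<Rightarrow> nat \<Rightarrow> nat" where
  "block_index m n = (LEAST k. n < m (Suc k))"

lemma finite_block [simp]: "finite (block m k)"
  by (simp add: block_def)

lemma less_block_index:
  assumes "strict_mono m"
  shows "n < m (Suc (block_index m n))"
  unfolding block_index_def
  by (rule LeastI[of _ n]) (use strict_mono_imp_increasing[OF assms, of "Suc n"] in simp)

lemma block_index_eq:
  assumes "strict_mono m" "n \<in> block m k"
  shows "block_index m n = k"
  unfolding block_index_def
proof (rule Least_equality)
  show "n < m (Suc k)" using assms(2) by (simp add: block_def)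
  fix l assume "n < m (Suc l)"
  then have "m k < m (Suc l)" using assms(2) by (simp add: block_def)
  then show "k \<le> l" using strict_mono_less[OF assms(1)] by simp
qed

lemma UN_block:
  assumes "strict_mono m"
  shows "(\<Union>k. block m k) = {m 0..}"
proof
  show "(\<Union>k. block m k) \<subseteq> {m 0..}"
    using strict_mono_less_eq[OF assms, of 0] by (fastforce simp: block_def intro: order_trans)
  show "{m 0..} \<subseteq> (\<Union>k. block m k)"
  proof
    fix n assume n: "n \<in> {m 0..}"
    have "m (block_index m n) \<le> n"
    proof (cases "block_index m n")
      case (Suc l)
      then show ?thesis using not_less_Least[of l "\<lambda>k. n < m (Suc k)"] by (simp add: block_index_def)
    qed (use n in simp)
    with less_block_index[OF assms, of n] show "n \<in> (\<Union>k. block m k)" by (auto simp: block_def)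
  qed
qed

lemma nowhere_dense_avoiding_late_blocks:
  assumes m: "strict_mono m"
  shows "nowhere_dense {x :: cantor. \<forall>k\<ge>l. x \<notin> cylinder s (block m k)}"
  unfolding nowhere_dense_iff_cylinder
proof (intro allI impI)
  fix x :: cantor and S :: "nat set" assume "finite S"
  then obtain n where n: "S \<subseteq> {..<n}" using finite_nat_iff_bounded by blast
  define y where "y = (\<lambda>i. if i < n then x i else s i)"
  define k where "k = max l n"
  have "n \<le> m k" using strict_mono_imp_increasing[OF m, of k] by (simp add: k_def)
  then have "cylinder y (block m k) = cylinder s (block m k)"
    by (intro cylinder_eq) (auto simp: cylinder_def y_def block_def)
  moreover have "y \<in> cylinder x S" using n by (auto simp: cylinder_def y_def)
  moreover have "l \<le> k" by (simp add: k_def)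
  ultimately show "\<exists>y\<in>cylinder x S. \<exists>T. finite T \<and>
      cylinder y T \<inter> {x. \<forall>k\<ge>l. x \<notin> cylinder s (block m k)} = {}"
    by (intro bexI[of _ y] exI[of _ "block m k"]) auto
qed

lemma meager_Compl_N_limsup_blocks:
  assumes "strict_mono m"
  shows "meager (- N_limsup (\<lambda>k. cylinder s (block m k)))"
proof -
  have "- N_limsup (\<lambda>k. cylinder s (block m k)) =
      (\<Union>l. {x. \<forall>k\<ge>l. x \<notin> cylinder s (block m k)})"
    by (auto simp: N_limsup_def infinite_nat_iff_unbounded_le)
  then show ?thesis
    unfolding meager_def
    by (intro exI[of _ "\<lambda>l. {x. \<forall>k\<ge>l. x \<notin> cylinder s (block m k)}"] conjI allI
        nowhere_dense_avoiding_late_blocks[OF assms])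
qed

lemma meager_avoiding_blocks:
  assumes "meager M"
  obtains m s where "strict_mono m" "M \<subseteq> - N_limsup (\<lambda>k. cylinder s (block m k))"
proof -
  obtain F where F: "\<And>n::nat. nowhere_dense (F n)" "M = (\<Union>n. F n)"
    using assms by (auto simp: meager_def)
  define G where "G k = (\<Union>i\<le>k. F i)" for k
  have G: "nowhere_dense (G k)" for k
    unfolding G_def using F(1) by (intro nowhere_dense_UN) simp_all
  have "\<exists>b>a. \<exists>s. cylinder s {a..<b} \<inter> G k = {}" for a k
    using nowhere_dense_avoiding_interval[OF G, of a k] by metis
  then have "\<exists>m. \<forall>k. True \<and> (m k < m (Suc k) \<and> (\<exists>s. cylinder s {m k..<m (Suc k)} \<inter> G k = {}))"
    by (intro dependent_nat_choice) simp_all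
  then obtain m t where m: "\<And>k. m k < m (Suc k)"
      and t: "\<And>k. cylinder (t k) (block m k) \<inter> G k = {}"
    unfolding block_def by metis
  have "strict_mono m" using m by (simp add: strict_mono_Suc_iff)
  define s where "s i = t (block_index m i) i" for i
  have "cylinder s (block m k) = cylinder (t k) (block m k)" for k
    using block_index_eq[OF \<open>strict_mono m\<close>] by (intro cylinder_eq) (simp add: cylinder_def s_def)
  with t have avoid: "cylinder s (block m k) \<inter> F n = {}" if "n \<le> k" for n k
    using that by (fastforce simp: G_def)
  have "M \<subseteq> - N_limsup (\<lambda>k. cylinder s (block m k))"
    using avoid unfolding F(2) N_limsup_def infinite_nat_iff_unbounded_le by blast
  with \<open>strict_mono m\<close> show ?thesis by (rule that)
qed

text \<open>Due to Jalali-Naini and Talagrand in the case of ideals.\<close>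
theorem meager_cantor_of_iff_blocks:
  assumes hereditary: "\<forall>A\<in>J. Pow A \<subseteq> J"
  shows "meager (cantor_of J) \<longleftrightarrow>
    (\<exists>m. strict_mono m \<and> (\<forall>A\<in>J. finite {k. block m k \<subseteq> A}))"
proof
  assume "meager (cantor_of J)"
  then obtain m s where m: "strict_mono m"
      and avoid: "cantor_of J \<subseteq> - N_limsup (\<lambda>k. cylinder s (block m k))"
    by (rule meager_avoiding_blocks)
  have "finite {k. block m k \<subseteq> A}" if "A \<in> J" for A
  proof -
    let ?B = "{i \<in> A. s i}"
    have "?B \<in> J" by (rule subsetD[OF bspec[OF hereditary that]]) simp
    then have "(\<lambda>i. i \<in> ?B) \<in> cantor_of J"
      unfolding cantor_of_def by (rule imageI)
    then have "finite {k. (\<lambda>i. i \<in> ?B) \<in> cylinder s (block m k)}"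
      using avoid by (auto simp: N_limsup_def)
    then show ?thesis by (rule finite_subset[rotated]) (auto simp: cylinder_def)
  qed
  with m show "\<exists>m. strict_mono m \<and> (\<forall>A\<in>J. finite {k. block m k \<subseteq> A})" by blast
next
  assume "\<exists>m. strict_mono m \<and> (\<forall>A\<in>J. finite {k. block m k \<subseteq> A})"
  then obtain m where m: "strict_mono m" and fin: "\<forall>A\<in>J. finite {k. block m k \<subseteq> A}" by blast
  have "cantor_of J \<subseteq> - N_limsup (\<lambda>k. cylinder (\<lambda>_. True) (block m k))"
    using fin by (auto simp: cantor_of_def N_limsup_def cylinder_def subset_eq)
  then show "meager (cantor_of J)"
    by (rule meager_subset[OF meager_Compl_N_limsup_blocks[OF m]])
qed

section \<open>The coin-tossing measure\<close>

instance bool :: second_countable_topology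
proof
  have "generate_topology (UNIV :: bool set set) = open"
    by (auto simp: fun_eq_iff discrete_topology_class.open_discrete intro: generate_topology.Basis)
  then show "\<exists>B::bool set set. countable B \<and> open = generate_topology B"
    by (intro exI[of _ UNIV]) (simp add: countable_finite)
qed

definition coin_measure :: "cantor measure" where
  "coin_measure = Pi\<^sub>M UNIV (\<lambda>_. measure_pmf (bernoulli_pmf (1/2)))"

lemma cantor_measure_eq: "cantor_measure = completion coin_measure"
  by (simp add: cantor_measure_def coin_measure_def)

interpretation fair_coins: product_prob_space "\<lambda>_. measure_pmf (bernoulli_pmf (1/2))" "UNIV :: nat set"
  by unfold_locales

interpretation coin: prob_space coin_measure
  unfolding coin_measure_def by (rule fair_coins.P.prob_space_axioms)

lemma sets_coin_measure: "sets coin_measure = sets borel"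
proof -
  have "sets coin_measure = sets (Pi\<^sub>M UNIV (\<lambda>_. borel :: bool measure))"
    unfolding coin_measure_def by (intro sets_PiM_cong) (simp_all add: sets_borel_eq_count_space)
  then show ?thesis by (simp add: sets_PiM_equal_borel)
qed

lemma space_coin_measure [simp]: "space coin_measure = UNIV"
  by (simp add: coin_measure_def space_PiM)

lemma Omega_bar_in_sets_coin: "c \<in> Omega_bar \<Longrightarrow> c n \<in> sets coin_measure"
  by (simp add: Omega_bar_def clopen_sets_def sets_coin_measure)

lemma cylinder_in_sets_coin: "finite S \<Longrightarrow> cylinder x S \<in> sets coin_measure"
  by (simp add: sets_coin_measure open_cylinder)

lemma cylinder_eq_prod_emb:
  assumes "\<And>i. space (M i) = UNIV"
  shows "cylinder x S = prod_emb UNIV M S (\<Pi>\<^sub>E i\<in>S. {x i})"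
  unfolding cylinder_def prod_emb_def using assms by (auto simp: space_PiM PiE_iff)

lemma measure_cylinder:
  assumes "finite S"
  shows "measure coin_measure (cylinder x S) = (1/2) ^ card S"
proof -
  have "measure coin_measure (cylinder x S) =
      (\<Prod>i\<in>S. measure (measure_pmf (bernoulli_pmf (1/2))) {x i})"
    unfolding coin_measure_def
    by (subst cylinder_eq_prod_emb[where M = "\<lambda>_. measure_pmf (bernoulli_pmf (1/2))"])
       (use assms in \<open>simp_all add: fair_coins.measure_PiM_emb\<close>)
  then show ?thesis by (simp add: measure_pmf_single)
qed

lemma (in product_prob_space) distr_PiM_coordinatewise:
  assumes f [measurable]: "\<And>i. i \<in> I \<Longrightarrow> f i \<in> measurable (M i) (M i)"
    and preserves: "\<And>i. i \<in> I \<Longrightarrow> distr (M i) (M i) (f i) = M i"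
  shows "distr (PiM I M) (PiM I M) (\<lambda>x. \<lambda>i\<in>I. f i (x i)) = PiM I M"
    (is "distr _ _ ?f = _")
proof (rule PiM_eq)
  fix J F assume J: "finite J" "J \<subseteq> I" and F: "\<And>j. j \<in> J \<Longrightarrow> F j \<in> sets (M j)"
  have f_measurable: "?f \<in> measurable (PiM I M) (PiM I M)"
    by measurable
  have "emeasure (distr (PiM I M) (PiM I M) ?f) (prod_emb I M J (Pi\<^sub>E J F)) =
      emeasure (PiM I M) (?f -` prod_emb I M J (Pi\<^sub>E J F) \<inter> space (PiM I M))"
    using J F by (intro emeasure_distr f_measurable sets_PiM_I) auto
  also have "?f -` prod_emb I M J (Pi\<^sub>E J F) \<inter> space (PiM I M) =
      prod_emb I M J (\<Pi>\<^sub>E j\<in>J. f j -` F j \<inter> space (M j))"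
    using J(2) measurable_space[OF f]
    by (fastforce simp: prod_emb_def space_PiM PiE_iff extensional_def)
  also have "emeasure (PiM I M) \<dots> = (\<Prod>j\<in>J. emeasure (M j) (f j -` F j \<inter> space (M j)))"
    using J F by (intro emeasure_PiM_emb) (auto intro: measurable_sets[OF f])
  also have "\<dots> = (\<Prod>j\<in>J. emeasure (distr (M j) (M j) (f j)) (F j))"
    using J(2) F by (intro prod.cong refl emeasure_distr[symmetric] f) auto
  also have "\<dots> = (\<Prod>j\<in>J. emeasure (M j) (F j))"
    using J(2) preserves by (intro prod.cong) auto
  finally show "emeasure (distr (PiM I M) (PiM I M) ?f) (prod_emb I M J (Pi\<^sub>E J F)) =
      (\<Prod>j\<in>J. emeasure (M j) (F j))" .
qed simp

lemma map_pmf_xor_fair_coin: "map_pmf (\<lambda>b. b \<noteq> s) (bernoulli_pmf (1/2)) = bernoulli_pmf (1/2)"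
proof -
  have "bij (\<lambda>b. b \<noteq> s)" by (rule o_bij[of "\<lambda>b. b \<noteq> s"]) auto
  then show ?thesis
    by (simp add: bernoulli_pmf_half_conv_pmf_of_set map_pmf_of_set_inj bij_is_inj bij_is_surj)
qed

lemma distr_flip: "distr coin_measure coin_measure (flip S) = coin_measure"
proof -
  let ?p = "bernoulli_pmf (1/2)"
  have "distr (measure_pmf ?p) (measure_pmf ?p) (\<lambda>b. b \<noteq> s) = measure_pmf ?p" for s
  proof -
    have "distr (measure_pmf ?p) (measure_pmf ?p) (\<lambda>b. b \<noteq> s) = measure_pmf (map_pmf (\<lambda>b. b \<noteq> s) ?p)"
      unfolding map_pmf_rep_eq by (rule distr_cong) simp_all
    then show ?thesis by (simp only: map_pmf_xor_fair_coin)
  qed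
  then show ?thesis
    using fair_coins.distr_PiM_coordinatewise[of "\<lambda>i b. b \<noteq> (i \<in> S)"]
    by (simp add: coin_measure_def flip_def[abs_def] restrict_UNIV)
qed

lemma measurable_flip: "flip S \<in> measurable coin_measure coin_measure"
  unfolding coin_measure_def flip_def
  by (rule measurable_PiM_single')
     (auto intro: measurable_compose[OF measurable_component_singleton])

lemma vimage_flip_in_sets: "A \<in> sets coin_measure \<Longrightarrow> flip S -` A \<in> sets coin_measure"
  using measurable_sets[OF measurable_flip] by simp

lemma measure_vimage_flip:
  "A \<in> sets coin_measure \<Longrightarrow> measure coin_measure (flip S -` A) = measure coin_measure A"
  using measure_distr[OF measurable_flip] by (simp add: distr_flip)

lemma alterations_in_sets:
  "finite Z \<Longrightarrow> A \<in> sets coin_measure \<Longrightarrow> alterations Z A \<in> sets coin_measure"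
  unfolding alterations_eq_UN_flip by (intro sets.finite_UN vimage_flip_in_sets) simp_all

lemma measure_alterations_le:
  assumes "finite Z" "A \<in> sets coin_measure"
  shows "measure coin_measure (alterations Z A) \<le> 2 ^ card Z * measure coin_measure A"
proof -
  have "measure coin_measure (alterations Z A) \<le> (\<Sum>S\<in>Pow Z. measure coin_measure (flip S -` A))"
    unfolding alterations_eq_UN_flip
    using assms vimage_flip_in_sets by (intro measure_UNION_le) auto
  also have "\<dots> = 2 ^ card Z * measure coin_measure A"
    using assms by (simp add: measure_vimage_flip card_Pow)
  finally show ?thesis .
qed

section \<open>Null sets and sequences of clopen sets\<close>

lemma outer_regular_via_embedding:
  fixes M :: "'a::topological_space measure"
    and f :: "'a \<Rightarrow> 'b::{second_countable_topology, complete_space}"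
  assumes sets_M: "sets M = sets borel" and fin: "emeasure M (space M) \<noteq> \<infinity>"
    and f: "continuous_on UNIV f" and g: "g \<in> borel_measurable borel" "\<And>x. g (f x) = x"
    and A: "A \<in> sets M"
  shows "emeasure M A = (INF U\<in>{U. A \<subseteq> U \<and> open U}. emeasure M U)"
proof (rule antisym)
  show "emeasure M A \<le> (INF U\<in>{U. A \<subseteq> U \<and> open U}. emeasure M U)"
    using sets_M by (intro INF_greatest emeasure_mono) auto
  have space_M: "space M = UNIV" using sets_eq_imp_space_eq[OF sets_M] by simp
  have f_M: "f \<in> borel_measurable M"
    using borel_measurable_continuous_onI[OF f] by (simp cong: measurable_cong_sets add: sets_M)
  have emeasure_distr_f: "emeasure (distr M borel f) B = emeasure M (f -` B)"
    if "B \<in> sets borel" for B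
    using emeasure_distr[OF f_M that] by (simp add: space_M)
  have g_A: "g -` A \<in> sets borel"
    using measurable_sets[OF g(1)] A sets_M by (metis Int_UNIV_right space_borel)
  have "(INF U\<in>{U. A \<subseteq> U \<and> open U}. emeasure M U)
      \<le> (INF V\<in>{V. g -` A \<subseteq> V \<and> open V}. emeasure M (f -` V))"
  proof (rule INF_mono)
    fix V assume V: "V \<in> {V. g -` A \<subseteq> V \<and> open V}"
    then have "f -` V \<in> {U. A \<subseteq> U \<and> open U}"
      using open_vimage[OF _ f, of V] by (auto simp: subset_eq g(2))
    then show "\<exists>U\<in>{U. A \<subseteq> U \<and> open U}. emeasure M U \<le> emeasure M (f -` V)" by blast
  qed
  also have "\<dots> = (INF V\<in>{V. g -` A \<subseteq> V \<and> open V}. emeasure (distr M borel f) V)"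
    by (intro INF_cong refl) (simp add: emeasure_distr_f)
  also have "\<dots> = emeasure (distr M borel f) (g -` A)"
    using fin by (intro outer_regular[symmetric] g_A) (simp_all add: emeasure_distr_f space_M)
  also have "\<dots> = emeasure M A"
    unfolding emeasure_distr_f[OF g_A] by (simp add: vimage_def g(2))
  finally show "(INF U\<in>{U. A \<subseteq> U \<and> open U}. emeasure M U) \<le> emeasure M A" .
qed

text \<open>There is no metric on \<^typ>\<open>bool\<close>, so the library's outer regularity is pulled back from
  \<^typ>\<open>nat \<Rightarrow> real\<close>.\<close>
lemma coin_outer_regular:
  assumes "A \<in> sets coin_measure"
  shows "emeasure coin_measure A = (INF U\<in>{U. A \<subseteq> U \<and> open U}. emeasure coin_measure U)"
proof (rule outer_regular_via_embedding)
  show "continuous_on UNIV (\<lambda>(x::cantor) i. of_bool (x i) :: real)"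
  proof (rule continuous_on_coordinatewise_then_product)
    fix i
    have "continuous_on UNIV (of_bool :: bool \<Rightarrow> real)"
      by (simp add: continuous_on_open_vimage discrete_topology_class.open_discrete)
    then show "continuous_on UNIV (\<lambda>x::cantor. of_bool (x i) :: real)"
      by (rule continuous_on_compose2) (auto intro: continuous_on_product_coordinates)
  qed
  have "(\<lambda>(y::nat \<Rightarrow> real) i. y i = 1) \<in> measurable borel (Pi\<^sub>M UNIV (\<lambda>_. borel :: bool measure))"
  proof (rule measurable_PiM_single')
    fix i
    have [measurable]: "(\<lambda>y::nat \<Rightarrow> real. y i) \<in> borel_measurable borel"
      by (intro borel_measurable_continuous_onI continuous_on_product_coordinates)
    have "Measurable.pred borel (\<lambda>y::nat \<Rightarrow> real. y i = 1)"
      by measurable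
    then show "(\<lambda>y::nat \<Rightarrow> real. y i = 1) \<in> measurable borel (borel :: bool measure)"
      by (simp only: measurable_cong_sets[OF refl sets_borel_eq_count_space])
  qed simp
  then show "(\<lambda>(y::nat \<Rightarrow> real) i. y i = 1) \<in> borel_measurable borel"
    by (simp add: sets_PiM_equal_borel cong: measurable_cong_sets)
qed (use assms coin.emeasure_space_1 in \<open>simp_all add: sets_coin_measure\<close>)

lemma null_set_open_cover:
  assumes "X \<in> null_sets coin_measure" "e > 0"
  obtains U where "open U" "X \<subseteq> U" "measure coin_measure U < e"
proof -
  have "(INF U\<in>{U. X \<subseteq> U \<and> open U}. emeasure coin_measure U) < ennreal e"
    using coin_outer_regular[of X] assms by (simp add: null_sets_def)
  then obtain U where "X \<subseteq> U" "open U" "emeasure coin_measure U < ennreal e"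
    by (auto simp: INF_less_iff)
  then show ?thesis
    using assms(2) by (intro that) (simp_all add: coin.emeasure_eq_measure ennreal_less_iff)
qed

lemma open_eq_disjoint_UN_clopen:
  fixes U :: "cantor set"
  assumes "open U"
  shows "\<exists>D :: nat \<Rightarrow> cantor set. range D \<subseteq> clopen_sets \<and> disjoint_family D \<and> (\<Union>n. D n) = U"
proof -
  define C where "C n = {x. cylinder x {..<n} \<subseteq> U}" for n
  have C: "open (C n)" "closed (C n)" for n
  proof -
    have "determined_by {..<n} (C n)"
      unfolding determined_by_def C_def using cylinder_eq by blast
    then show "open (C n)" "closed (C n)"
      by (auto intro: open_if_determined_by closed_if_determined_by)
  qed
  have "range (disjointed C) \<subseteq> clopen_sets"
    unfolding disjointed_def clopen_sets_def using C by (auto intro!: open_Diff closed_Diff)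
  moreover have "(\<Union>n. C n) = U"
  proof
    show "(\<Union>n. C n) \<subseteq> U" unfolding C_def using self_in_cylinder by blast
    show "U \<subseteq> (\<Union>n. C n)"
    proof
      fix x assume "x \<in> U"
      then obtain S where S: "finite S" "cylinder x S \<subseteq> U"
        using open_contains_cylinder[OF assms] by blast
      then obtain n where "S \<subseteq> {..<n}" using finite_nat_iff_bounded by blast
      then have "x \<in> C n" using S(2) cylinder_antimono by (fastforce simp: C_def)
      then show "x \<in> (\<Union>n. C n)" by blast
    qed
  qed
  ultimately show ?thesis
    by (intro exI[of _ "disjointed C"]) (simp add: disjoint_family_disjointed UN_disjointed_eq)
qed

lemma N_limsup_eq_limsup: "N_limsup c = limsup c"
  unfolding limsup_INF_SUP N_limsup_def infinite_nat_iff_unbounded_le by auto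

lemma null_N_limsup:
  assumes "\<And>k. U k \<in> sets coin_measure" "\<And>k. measure coin_measure (U k) \<le> f k" "summable f"
  shows "N_limsup U \<in> null_sets coin_measure"
  unfolding N_limsup_eq_limsup
proof (rule borel_cantelli_limsup1)
  show "summable (\<lambda>k. measure coin_measure (U k))"
    by (rule summable_comparison_test'[OF assms(3), of 0]) (use assms(2) in simp)
qed (use assms(1) in \<open>auto simp: coin.emeasure_eq_measure\<close>)

lemma N_limsup_enumerate_disjoint:
  fixes D :: "nat \<Rightarrow> nat \<Rightarrow> cantor set"
  assumes "\<And>k. disjoint_family (D k)"
  shows "N_limsup (\<lambda>n. case prod_decode n of (k, j) \<Rightarrow> D k j) = N_limsup (\<lambda>k. \<Union>j. D k j)"
proof -
  have "finite {n. x \<in> (case prod_decode n of (k, j) \<Rightarrow> D k j)} \<longleftrightarrow> finite {k. x \<in> (\<Union>j. D k j)}" for x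
  proof -
    let ?P = "{(k, j). x \<in> D k j}"
    have "{n. x \<in> (case prod_decode n of (k, j) \<Rightarrow> D k j)} = prod_encode ` ?P"
    proof (intro equalityI subsetI)
      fix n assume "n \<in> {n. x \<in> (case prod_decode n of (k, j) \<Rightarrow> D k j)}"
      then show "n \<in> prod_encode ` ?P"
        by (intro image_eqI[of _ _ "prod_decode n"]) (auto simp: split_beta)
    qed auto
    moreover have "{k. x \<in> (\<Union>j. D k j)} = fst ` ?P" by force
    moreover have "inj_on fst ?P"
      using assms by (auto simp: inj_on_def disjoint_family_on_def)
    ultimately show ?thesis by (simp add: finite_image_iff inj_prod_encode)
  qed
  then show ?thesis by (simp add: N_limsup_def)
qed

lemma null_set_subset_N_limsup:
  assumes "X \<in> null_sets cantor_measure"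
  obtains c where "c \<in> Omega_bar" "X \<subseteq> N_limsup c"
proof -
  obtain Y where Y: "Y \<in> null_sets coin_measure" "X \<subseteq> Y"
    using assms unfolding cantor_measure_eq null_sets_completion_iff2 by blast
  have "\<exists>U. open U \<and> Y \<subseteq> U \<and> measure coin_measure U < (1/2) ^ k" for k :: nat
    by (rule null_set_open_cover[OF Y(1), of "(1/2) ^ k"]) auto
  then obtain U where U: "\<And>k. open (U k)" "\<And>k. Y \<subseteq> U k"
      and small: "\<And>k. measure coin_measure (U k) < (1/2) ^ k"
    by metis
  obtain D :: "nat \<Rightarrow> nat \<Rightarrow> cantor set" where clopen: "\<And>k. range (D k) \<subseteq> clopen_sets"
      and D: "\<And>k. disjoint_family (D k)" "\<And>k. (\<Union>j. D k j) = U k"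
    using open_eq_disjoint_UN_clopen[OF U(1)] by metis
  define c where "c n = (case prod_decode n of (k, j) \<Rightarrow> D k j)" for n
  have limsup: "N_limsup c = N_limsup U"
    using N_limsup_enumerate_disjoint[OF D(1)] by (simp add: c_def[abs_def] D(2))
  have "N_limsup U \<in> null_sets coin_measure"
  proof (rule null_N_limsup)
    show "measure coin_measure (U k) \<le> (1/2) ^ k" for k using small by (rule less_imp_le)
  qed (use U(1) in \<open>simp_all add: sets_coin_measure\<close>)
  then have "c \<in> Omega_bar"
    using clopen
    by (auto simp: Omega_bar_def cantor_measure_eq limsup c_def split_beta
        intro: null_sets_completionI)
  moreover have "X \<subseteq> N_limsup c"
    unfolding limsup using Y(2) U(2) by (auto simp: N_limsup_def subset_eq)
  ultimately show ?thesis by (rule that)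
qed

section \<open>Meager ideals\<close>

lemma Omega_bar_comp:
  assumes c: "c \<in> Omega_bar" and f: "\<And>k. finite (f -` {k})"
  shows "c \<circ> f \<in> Omega_bar"
proof -
  have finite_vimage: "finite (f -` K)" if "finite K" for K
    using finite_finite_vimage_IntI[OF that, of f UNIV] f by simp
  have "N_limsup (c \<circ> f) \<subseteq> N_limsup c"
  proof
    fix x assume "x \<in> N_limsup (c \<circ> f)"
    then have "infinite (f -` {k. x \<in> c k})" by (simp add: N_limsup_def vimage_def)
    then have "infinite {k. x \<in> c k}" using finite_vimage by (rule contrapos_nn)
    then show "x \<in> N_limsup c" by (simp add: N_limsup_def)
  qed
  then show ?thesis
    using c by (auto simp: Omega_bar_def cantor_measure_eq intro: null_sets_completion_subset)
qed

lemma ideal_on_omega_hereditary: "ideal_on_omega J \<Longrightarrow> \<forall>A\<in>J. Pow A \<subseteq> J"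
  by (auto simp: ideal_on_omega_def)

lemma N_J_family_subset_null:
  assumes "ideal_on_omega J"
  shows "N_J_family J \<subseteq> null_ideal"
proof
  fix X assume "X \<in> N_J_family J"
  then obtain c where c: "c \<in> Omega_bar" "X \<subseteq> N_J_set J c"
    unfolding N_J_family_def by blast
  have "N_J_set J c \<subseteq> N_limsup c"
    using assms by (auto simp: N_J_set_def N_limsup_def positive_sets_def ideal_on_omega_def)
  with c(2) have "X \<subseteq> N_limsup c" by simp
  moreover have "N_limsup c \<in> null_sets cantor_measure" using c(1) by (simp add: Omega_bar_def)
  ultimately show "X \<in> null_ideal"
    unfolding null_ideal_def cantor_measure_eq by (rule null_sets_completion_subset)
qed

lemma null_subset_N_J_family_if_meager:
  assumes J: "ideal_on_omega J" and meager: "meager (cantor_of J)"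
  shows "null_ideal \<subseteq> N_J_family J"
proof
  fix X assume "X \<in> null_ideal"
  then obtain c where c: "c \<in> Omega_bar" "X \<subseteq> N_limsup c"
    using null_set_subset_N_limsup unfolding null_ideal_def by auto
  obtain m where m: "strict_mono m" and fin: "\<And>A. A \<in> J \<Longrightarrow> finite {k. block m k \<subseteq> A}"
    using meager_cantor_of_iff_blocks[OF ideal_on_omega_hereditary[OF J]] meager by auto
  have "block_index m -` {k} \<subseteq> {..<m (Suc k)}" for k
    using less_block_index[OF m] by auto
  then have "finite (block_index m -` {k})" for k
    by (rule finite_subset) simp
  with c(1) have "c \<circ> block_index m \<in> Omega_bar"
    by (rule Omega_bar_comp)
  moreover have "X \<subseteq> N_J_set J (c \<circ> block_index m)"
  proof
    fix x assume "x \<in> X"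
    then have "infinite {k. x \<in> c k}" using c(2) by (auto simp: N_limsup_def)
    moreover have "{k. x \<in> c k} \<subseteq> {k. block m k \<subseteq> {n. x \<in> c (block_index m n)}}"
      using block_index_eq[OF m] by auto
    ultimately have "{n. x \<in> c (block_index m n)} \<notin> J"
      using fin finite_subset by blast
    then show "x \<in> N_J_set J (c \<circ> block_index m)" by (simp add: N_J_set_def positive_sets_def)
  qed
  ultimately show "X \<in> N_J_family J" unfolding N_J_family_def by blast
qed

section \<open>Nonmeager ideals\<close>

abbreviation dyadic_block :: "nat \<Rightarrow> nat set" where
  "dyadic_block \<equiv> block (\<lambda>k. 2 ^ k)"

definition infinitely_often_constant :: "bool \<Rightarrow> cantor set" where
  "infinitely_often_constant b = N_limsup (\<lambda>k. cylinder (\<lambda>_. b) (dyadic_block k))"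

definition escaping_set :: "cantor set" where
  "escaping_set = infinitely_often_constant False - infinitely_often_constant True"

lemma null_infinitely_often_constant: "infinitely_often_constant b \<in> null_sets coin_measure"
  unfolding infinitely_often_constant_def
proof (rule null_N_limsup)
  fix k
  let ?x = "\<lambda>_. b"
  have "measure coin_measure (cylinder ?x (dyadic_block k)) = (1/2) ^ card (dyadic_block k)"
    by (rule measure_cylinder) simp
  also have "\<dots> \<le> (1/2) ^ k"
    by (rule power_decreasing) (auto simp: block_def intro: less_imp_le[OF less_exp])
  finally show "measure coin_measure (cylinder ?x (dyadic_block k)) \<le> (1/2) ^ k" .
qed (simp_all add: cylinder_in_sets_coin)

lemma escaping_set_null: "escaping_set \<in> null_ideal"
  unfolding null_ideal_def cantor_measure_eq escaping_set_def
  by (rule null_sets_completion_subset[OF Diff_subset null_sets_completionI])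
     (rule null_infinitely_often_constant)

lemma escaping_set_meager: "escaping_set \<in> meager_ideal"
proof -
  have "meager (- infinitely_often_constant True)"
    unfolding infinitely_often_constant_def
    by (rule meager_Compl_N_limsup_blocks) (simp add: strict_mono_Suc_iff)
  then show ?thesis
    unfolding meager_ideal_def escaping_set_def by (auto elim: meager_subset)
qed

definition erase :: "'i set \<Rightarrow> ('i \<Rightarrow> bool) \<Rightarrow> 'i \<Rightarrow> bool" where
  "erase Z x = (\<lambda>i. i \<notin> Z \<and> x i)"

lemma erase_in_escaping_set:
  assumes erased: "infinite {k. dyadic_block k \<subseteq> Z}"
    and x: "x \<notin> infinitely_often_constant True"
  shows "erase Z x \<in> escaping_set"
proof -
  have "{k. dyadic_block k \<subseteq> Z} \<subseteq> {k. erase Z x \<in> cylinder (\<lambda>_. False) (dyadic_block k)}"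
    by (auto simp: erase_def cylinder_def)
  then have "erase Z x \<in> infinitely_often_constant False"
    using erased finite_subset unfolding infinitely_often_constant_def N_limsup_def by blast
  moreover have "{k. erase Z x \<in> cylinder (\<lambda>_. True) (dyadic_block k)} \<subseteq>
      {k. x \<in> cylinder (\<lambda>_. True) (dyadic_block k)}"
    by (auto simp: erase_def cylinder_def)
  then have "erase Z x \<notin> infinitely_often_constant True"
    using x finite_subset unfolding infinitely_often_constant_def N_limsup_def by blast
  ultimately show ?thesis by (simp add: escaping_set_def)
qed

lemma vimage_erase_in_sets:
  assumes "A \<in> sets coin_measure"
  shows "erase Z -` A \<in> sets coin_measure"
proof -
  have "erase Z \<in> measurable coin_measure coin_measure"
    unfolding coin_measure_def erase_def
    by (rule measurable_PiM_single')
       (auto intro: measurable_compose[OF measurable_component_singleton])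
  from measurable_sets[OF this assms] show ?thesis by simp
qed

text \<open>At each point, erasing finitely many coordinates amounts to one of finitely many
  measure-preserving flips.\<close>
lemma measure_vimage_erase_le:
  assumes S: "finite S" and D: "determined_by S D"
  shows "measure coin_measure (erase Z -` D) \<le> 2 ^ card (Z \<inter> S) * measure coin_measure D"
proof -
  have D_sets: "D \<in> sets coin_measure"
    using open_if_determined_by[OF S D] by (simp add: sets_coin_measure)
  have "erase Z -` D \<subseteq> alterations (Z \<inter> S) D"
  proof
    fix x assume "x \<in> erase Z -` D"
    then have "erase (Z \<inter> S) x \<in> D"
      using determined_by_cong[OF D, of "erase (Z \<inter> S) x" "erase Z x"] by (simp add: erase_def)
    moreover have "x \<in> cylinder (erase (Z \<inter> S) x) (- (Z \<inter> S))"
      by (simp add: cylinder_def erase_def)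
    ultimately show "x \<in> alterations (Z \<inter> S) D" unfolding alterations_def by blast
  qed
  then have "measure coin_measure (erase Z -` D) \<le> measure coin_measure (alterations (Z \<inter> S) D)"
    using S D_sets by (intro coin.finite_measure_mono) (auto intro: alterations_in_sets)
  also have "\<dots> \<le> 2 ^ card (Z \<inter> S) * measure coin_measure D"
    using S D_sets by (intro measure_alterations_le) auto
  finally show ?thesis .
qed

definition tail_measure :: "(nat \<Rightarrow> cantor set) \<Rightarrow> nat \<Rightarrow> real" where
  "tail_measure c m = measure coin_measure (\<Union>n\<in>{m..}. c n)"

lemma tail_measure_tendsto_0:
  assumes "c \<in> Omega_bar"
  shows "tail_measure c \<longlonglongrightarrow> 0"
proof -
  note sets = Omega_bar_in_sets_coin[OF assms]
  have lim: "N_limsup c = (\<Inter>m. \<Union>n\<in>{m..}. c n)"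
    by (simp add: N_limsup_eq_limsup limsup_INF_SUP)
  then have "N_limsup c \<in> sets coin_measure" using sets by auto
  then have "N_limsup c \<in> null_sets coin_measure"
    using assms by (simp add: Omega_bar_def cantor_measure_eq null_sets_completion_iff)
  then have "measure coin_measure (\<Inter>m. \<Union>n\<in>{m..}. c n) = 0"
    by (simp add: lim measure_eq_0_null_sets)
  moreover have "(\<lambda>m. measure coin_measure (\<Union>n\<in>{m..}. c n))
      \<longlonglongrightarrow> measure coin_measure (\<Inter>m. \<Union>n\<in>{m..}. c n)"
  proof (rule coin.finite_Lim_measure_decseq)
    show "decseq (\<lambda>m. \<Union>n\<in>{m..}. c n)" unfolding decseq_def by (intro allI impI UN_mono) auto
  qed (use sets in auto)
  ultimately show ?thesis by (simp add: tail_measure_def[abs_def])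
qed

lemma ex_small_tail:
  assumes "c \<in> Omega_bar" "e > 0"
  shows "\<exists>m>a. tail_measure c m \<le> e"
proof -
  have "\<forall>\<^sub>F m in sequentially. tail_measure c m < e"
    using tail_measure_tendsto_0[OF assms(1)] assms(2) by (rule order_tendstoD(2))
  with eventually_gt_at_top[of a]
  have "\<forall>\<^sub>F m in sequentially. m > a \<and> tail_measure c m \<le> e"
    by eventually_elim simp
  from eventually_happens'[OF _ this] show ?thesis by simp
qed

lemma ex_dyadic_determined:
  fixes a b :: nat
  assumes "\<And>n. c n \<in> clopen_sets"
  shows "\<exists>j>a. \<forall>n<b. determined_by {..<2 ^ j} (c n)"
proof -
  have "\<exists>d. determined_by {..<d} (c n)" for n
  proof -
    have "open (c n)" "closed (c n)" using assms by (simp_all add: clopen_sets_def)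
    then obtain S where S: "finite S" "determined_by S (c n)"
      by (rule clopen_determined_by_finite)
    obtain d where "S \<subseteq> {..<d}" using S(1) finite_nat_iff_bounded by blast
    with S(2) show ?thesis by (blast intro: determined_by_mono)
  qed
  then obtain d where d: "\<And>n. determined_by {..<d n} (c n)" by metis
  define j where "j = Suc (a + (\<Sum>n<b. d n))"
  have "determined_by {..<2 ^ j} (c n)" if "n < b" for n
  proof (rule determined_by_mono[OF d])
    have "d n \<le> (\<Sum>n<b. d n)" using that by (intro member_le_sum) auto
    also have "\<dots> \<le> j" by (simp add: j_def)
    also have "\<dots> \<le> 2 ^ j" by (rule less_imp_le[OF less_exp])
    finally show "{..<d n} \<subseteq> {..<2 ^ j}" by auto
  qed
  moreover have "a < j" by (simp add: j_def)
  ultimately show ?thesis by blast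
qed

text \<open>The blocks with indices \<open>j 1 < j 2 < \<dots>\<close> can be erased: the sets \<open>c n\<close> with \<open>n < m k\<close> do not
  see the block \<open>j (k + 1)\<close> or later ones, while those with \<open>n \<ge> m k\<close> are tiny compared to the
  measure \<open>2 ^ (- 2 ^ (j k + 1))\<close> of a cylinder fixing all coordinates of the blocks up to \<open>j k\<close>.\<close>
definition separating_scales :: "(nat \<Rightarrow> cantor set) \<Rightarrow> (nat \<Rightarrow> nat) \<Rightarrow> (nat \<Rightarrow> nat) \<Rightarrow> bool" where
  "separating_scales c j m \<longleftrightarrow> strict_mono j \<and> strict_mono m \<and>
     (\<forall>k. \<forall>n<m k. determined_by {..<2 ^ j (Suc k)} (c n)) \<and>
     (\<forall>k. 2 ^ 2 ^ Suc (j k) * tail_measure c (m k) \<le> (1/2) ^ (k + 2))"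

lemma ex_separating_scales:
  assumes c: "c \<in> Omega_bar"
  obtains j m where "separating_scales c j m"
proof -
  define small where
    "small k p \<longleftrightarrow> 2 ^ 2 ^ Suc (fst p) * tail_measure c (snd p) \<le> (1/2) ^ (k + 2)"
    for k :: nat and p :: "nat \<times> nat"
  define unseen where "unseen p q \<longleftrightarrow>
      fst p < fst q \<and> snd p < snd q \<and> (\<forall>n<snd p. determined_by {..<2 ^ fst q} (c n))"
    for p q :: "nat \<times> nat"
  have ex_small: "\<exists>m>a. small k (j, m)" for a j k
  proof -
    have "\<exists>m>a. tail_measure c m \<le> (1/2) ^ (k + 2) / 2 ^ 2 ^ Suc j"
      using c by (rule ex_small_tail) simp
    then show ?thesis by (simp add: small_def field_simps)
  qed
  have "\<exists>f. \<forall>k. small k (f k) \<and> unseen (f k) (f (Suc k))"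
  proof (rule dependent_nat_choice)
    show "\<exists>p. small 0 p" using ex_small by blast
    fix p k
    obtain j where "j > fst p" "\<forall>n<snd p. determined_by {..<2 ^ j} (c n)"
      using ex_dyadic_determined[of c "fst p" "snd p"] c by (auto simp: Omega_bar_def)
    moreover obtain m where "m > snd p" "small (Suc k) (j, m)" using ex_small by blast
    ultimately show "\<exists>q. small (Suc k) q \<and> unseen p q"
      by (intro exI[of _ "(j, m)"]) (simp add: unseen_def)
  qed
  then obtain f where "\<And>k. small k (f k)" "\<And>k. unseen (f k) (f (Suc k))" by blast
  then have "separating_scales c (fst \<circ> f) (snd \<circ> f)"
    by (simp add: separating_scales_def small_def unseen_def strict_mono_Suc_iff)
  then show ?thesis by (rule that)
qed

definition erased_blocks :: "(nat \<Rightarrow> nat) \<Rightarrow> nat set \<Rightarrow> nat set" where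
  "erased_blocks j K = (\<Union>i\<in>K. dyadic_block (j (Suc i)))"

lemma erased_blocks_below:
  assumes j: "strict_mono j" and k: "k \<notin> K"
  shows "erased_blocks j K \<inter> {..<2 ^ j (Suc (Suc k))} \<subseteq> {..<2 ^ Suc (j k)}"
proof
  fix n assume "n \<in> erased_blocks j K \<inter> {..<2 ^ j (Suc (Suc k))}"
  then obtain i where i: "i \<in> K" "2 ^ j (Suc i) \<le> n" "n < 2 ^ Suc (j (Suc i))"
      "n < 2 ^ j (Suc (Suc k))"
    by (auto simp: erased_blocks_def block_def)
  then have "(2::nat) ^ j (Suc i) < 2 ^ j (Suc (Suc k))" by (simp only: order_le_less_trans)
  then have "i \<le> k" using strict_mono_less[OF j] by simp
  then have "Suc i \<le> k" using i(1) k by (cases "i = k") auto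
  then have "j (Suc i) \<le> j k" using strict_mono_less_eq[OF j] by simp
  then have "(2::nat) ^ Suc (j (Suc i)) \<le> 2 ^ Suc (j k)" by (intro power_increasing) simp_all
  with i(3) show "n \<in> {..<2 ^ Suc (j k)}" unfolding lessThan_iff by (rule less_le_trans)
qed

lemma measure_vimage_erase_blocks_le:
  assumes c: "c \<in> Omega_bar" and scales: "separating_scales c j m" and k: "k \<notin> K"
  shows "measure coin_measure (erase (erased_blocks j K) -` (\<Union>n\<in>block m k. c n)) \<le> (1/2) ^ (k + 2)"
    (is "measure _ (erase ?Z -` ?D) \<le> _")
proof -
  define S :: "nat set" where "S = {..<2 ^ j (Suc (Suc k))}"
  have j: "strict_mono j"
    and small: "2 ^ 2 ^ Suc (j k) * tail_measure c (m k) \<le> (1/2) ^ (k + 2)"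
    using scales by (auto simp: separating_scales_def)
  have "determined_by S (c n)" if "n \<in> block m k" for n
    using that scales by (simp add: separating_scales_def S_def block_def)
  then have D: "determined_by S ?D" by (rule determined_by_UN)
  have "card (?Z \<inter> S) \<le> 2 ^ Suc (j k)"
    using card_mono[OF finite_lessThan erased_blocks_below[OF j k]] by (simp add: S_def)
  then have pow: "(2::real) ^ card (?Z \<inter> S) \<le> 2 ^ 2 ^ Suc (j k)"
    by (rule power_increasing) simp
  have tail: "measure coin_measure ?D \<le> tail_measure c (m k)"
    unfolding tail_measure_def using Omega_bar_in_sets_coin[OF c]
    by (intro coin.finite_measure_mono) (auto simp: block_def)
  have "measure coin_measure (erase ?Z -` ?D) \<le> 2 ^ card (?Z \<inter> S) * measure coin_measure ?D"
    using D by (intro measure_vimage_erase_le) (simp_all add: S_def)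
  also have "\<dots> \<le> 2 ^ 2 ^ Suc (j k) * tail_measure c (m k)"
    using pow tail by (rule mult_mono) simp_all
  finally show ?thesis using small by linarith
qed

lemma (in prob_space) ex_not_in_UN:
  assumes E: "\<And>k::nat. E k \<in> events" "\<And>k. prob (E k) \<le> f k" and f: "f sums s" "s < 1"
    and N: "N \<in> null_sets M"
  obtains x where "x \<in> space M" "x \<notin> N" "\<And>k. x \<notin> E k"
proof -
  have summable: "summable (\<lambda>k. prob (E k))"
    by (rule summable_comparison_test'[OF sums_summable[OF f(1)], of 0]) (use E(2) in simp)
  have "prob ((\<Union>k. E k) \<union> N) = prob (\<Union>k. E k)"
    using E(1) N by (intro measure_Un_null_set) auto
  also have "\<dots> \<le> (\<Sum>k. prob (E k))"
    using E(1) summable by (intro finite_measure_subadditive_countably) auto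
  also have "\<dots> \<le> (\<Sum>k. f k)"
    using E(2) summable sums_summable[OF f(1)] by (rule suminf_le)
  also have "\<dots> < 1" using f sums_unique by metis
  finally have "(\<Union>k. E k) \<union> N \<noteq> space M" using prob_space by auto
  moreover have "(\<Union>k. E k) \<union> N \<subseteq> space M"
    using sets.sets_into_space[OF E(1)] sets.sets_into_space[OF null_setsD2[OF N]] by blast
  ultimately show ?thesis using that by blast
qed

lemma ex_erased_inside_blocks:
  assumes c: "c \<in> Omega_bar" and scales: "separating_scales c j m"
  obtains x where "x \<notin> infinitely_often_constant True"
    "{n. erase (erased_blocks j K) x \<in> c n} \<subseteq> {..<m 0} \<union> (\<Union>k\<in>K. block m k)"
proof -
  define E where
    "E k = (if k \<in> K then {} else erase (erased_blocks j K) -` (\<Union>n\<in>block m k. c n))" for k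
  have E: "E k \<in> sets coin_measure" for k
    using Omega_bar_in_sets_coin[OF c] by (auto simp: E_def intro!: vimage_erase_in_sets)
  have E_small: "measure coin_measure (E k) \<le> (1/2) ^ (k + 2)" for k
    using measure_vimage_erase_blocks_le[OF c scales, of k K] by (simp add: E_def)
  have half: "(\<lambda>k. (1/2::real) ^ (k + 2)) sums (1/2)"
    using sums_mult[OF geometric_sums[of "1/2 :: real"], of "1/4"]
    by (simp add: power_add mult.commute)
  obtain x where x: "x \<notin> infinitely_often_constant True" "\<And>k. x \<notin> E k"
    by (rule coin.ex_not_in_UN[OF E E_small half _ null_infinitely_often_constant[of True]]) simp_all
  have "k \<in> K" if "n \<in> block m k" "erase (erased_blocks j K) x \<in> c n" for k n
    using x(2)[of k] that by (auto simp: E_def split: if_splits)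
  moreover have "UNIV = {..<m 0} \<union> (\<Union>k. block m k)"
    using UN_block[of m] scales by (auto simp: separating_scales_def)
  ultimately have "{n. erase (erased_blocks j K) x \<in> c n} \<subseteq> {..<m 0} \<union> (\<Union>k\<in>K. block m k)"
    by blast
  with x(1) show ?thesis by (rule that)
qed

lemma escaping_point_inside_blocks:
  assumes c: "c \<in> Omega_bar" and scales: "separating_scales c j m" and K: "infinite K"
  shows "\<exists>y\<in>escaping_set. {n. y \<in> c n} \<subseteq> {..<m 0} \<union> (\<Union>k\<in>K. block m k)"
proof -
  let ?Z = "erased_blocks j K"
  obtain x where x: "x \<notin> infinitely_often_constant True"
      and inside: "{n. erase ?Z x \<in> c n} \<subseteq> {..<m 0} \<union> (\<Union>k\<in>K. block m k)"
    using ex_erased_inside_blocks[OF c scales] .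
  have j: "strict_mono j" using scales by (simp add: separating_scales_def)
  have "infinite ((j \<circ> Suc) ` K)"
    using K j by (simp add: finite_image_iff inj_on_def strict_mono_eq)
  moreover have "(j \<circ> Suc) ` K \<subseteq> {k. dyadic_block k \<subseteq> ?Z}" by (auto simp: erased_blocks_def)
  ultimately have "infinite {k. dyadic_block k \<subseteq> ?Z}" using finite_subset by blast
  then have "erase ?Z x \<in> escaping_set" using x by (rule erase_in_escaping_set)
  with inside show ?thesis by blast
qed

lemma escaping_set_not_in_N_J_family:
  assumes J: "ideal_on_omega J" and nonmeager: "\<not> meager (cantor_of J)"
  shows "escaping_set \<notin> N_J_family J"
proof
  assume "escaping_set \<in> N_J_family J"
  then obtain c where c: "c \<in> Omega_bar" "escaping_set \<subseteq> N_J_set J c"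
    unfolding N_J_family_def by blast
  obtain j m where scales: "separating_scales c j m"
    using ex_separating_scales[OF c(1)] .
  then have m: "strict_mono m" by (simp add: separating_scales_def)
  obtain A where A: "A \<in> J" "infinite {k. block m k \<subseteq> A}"
    using meager_cantor_of_iff_blocks[OF ideal_on_omega_hereditary[OF J]] nonmeager m by auto
  obtain y where y: "y \<in> escaping_set" "{n. y \<in> c n} \<subseteq> {..<m 0} \<union> A"
    using escaping_point_inside_blocks[OF c(1) scales A(2)] by blast
  have "{..<m 0} \<union> A \<in> J" using J A(1) by (simp add: ideal_on_omega_def)
  then have "{n. y \<in> c n} \<in> J" using ideal_on_omega_hereditary[OF J] y(2) by blast
  moreover have "{n. y \<in> c n} \<notin> J"
    using y(1) c(2) by (auto simp: N_J_set_def positive_sets_def)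
  ultimately show False by simp
qed

theorem theorem3p7:
  fixes J :: "nat set set"
  assumes "ideal_on_omega J"
  shows "(N_J_family J \<subset> null_ideal \<longleftrightarrow> \<not> (meager_ideal \<inter> null_ideal \<subseteq> N_J_family J)) \<and>
         (\<not> (meager_ideal \<inter> null_ideal \<subseteq> N_J_family J) \<longleftrightarrow> \<not> meager (cantor_of J))"
proof (cases "meager (cantor_of J)")
  case True
  then have "null_ideal \<subseteq> N_J_family J"
    by (rule null_subset_N_J_family_if_meager[OF assms])
  with True show ?thesis by blast
next
  case False
  have "escaping_set \<in> meager_ideal \<inter> null_ideal - N_J_family J"
    using escaping_set_meager escaping_set_null escaping_set_not_in_N_J_family[OF assms False] by blast
  with False N_J_family_subset_null[OF assms] show ?thesis by blast
qed

end
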